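(* The following claim is false for every fixed real $r > 0$: "if $(A_1,A_2)$ is sampled uniformly from $\mathcal{B}_X^2$, where $A_i = \begin{bmatrix} a_i & b_i \\ c_i & d_i \end{bmatrix}$, then $$\left| \frac{a_1}{c_1} - \frac{a_2}{c_2} \right| > r$$ holds with probability $1+o(1)$ as $X \to \infty$." That is, for every $r > 0$, the proportion of pairs $(A_1,A_2) \in \mathcal{B}_X^2$ satisfying $c_1 c_2 \ne 0$ and $\left| \frac{a_1}{c_1} - \frac{a_2}{c_2} \right| > r$ does not tend to $1$ as $X \to \infty$.
   Context: For $A \in \mathrm{SL}_2(\mathbb{Z})$ let $\|A\|_{op} = \sqrt{\lambda_{\max}(A^t A)}$, where $\lambda_{\max}$ denotes the largest eigenvalue (so $\|A\|_{op}$ is the operator norm of $A$). For $X > 0$ let $\mathcal{B}_X = \{A \in \mathrm{SL}_2(\mathbb{Z}) : \|A\|_{op} \le X\}$, a finite set. *)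

theory Defs
  imports "Jordan_Normal_Form.Spectral_Radius"
begin

definition SL2Z :: "int mat set" where
  "SL2Z = {A \<in> carrier_mat 2 2. Determinant.det A = 1}"

(* Max is meaningful here: for a real matrix A of positive size, A^T A is real symmetric,
   so its real spectrum is finite and nonempty (and nonnegative). *)
definition op_norm :: "real mat \<Rightarrow> real" where
  "op_norm A = sqrt (Max (spectrum (transpose_mat A * A)))"

definition SL2Z_ball :: "real \<Rightarrow> int mat set" where
  "SL2Z_ball X = {A \<in> SL2Z. op_norm (map_mat real_of_int A) \<le> X}"

(* Entries are indexed from 0, so a = A $$ (0,0) and c = A $$ (1,0). *)
definition column_ratio :: "int mat \<Rightarrow> real" where
  "column_ratio A = real_of_int (A $$ (0,0)) / real_of_int (A $$ (1,0))"

(* Since x / 0 = 0 in HOL, the condition that both ratios be defined is imposed explicitly. *)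
definition separated_pairs :: "real \<Rightarrow> real \<Rightarrow> (int mat \<times> int mat) set" where
  "separated_pairs r X = {(A1, A2). A1 \<in> SL2Z_ball X \<and> A2 \<in> SL2Z_ball X \<and>
     A1 $$ (1,0) * A2 $$ (1,0) \<noteq> 0 \<and> \<bar>column_ratio A1 - column_ratio A2\<bar> > r}"

(* The probability of separated_pairs under the uniform distribution on the finite set
   SL2Z_ball X \<times> SL2Z_ball X, which is nonempty for X \<ge> 1. *)
definition separated_proportion :: "real \<Rightarrow> real \<Rightarrow> real" where
  "separated_proportion r X =
     real (card (separated_pairs r X)) / real (card (SL2Z_ball X \<times> SL2Z_ball X))"

end

(* Left multiplication by the rotation [[0,-1],[1,0]] preserves SL2Z and the operator norm and
   turns the ratio a/c into -c/a. Hence at least half of every ball consists of matrices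
   with a/c in [-1,1]. Cutting [-1,1] into N pieces shorter than r, one piece receives at least
   a proportion 1/(2N) of the ball, so a proportion at least 1/(2N)^2 of all pairs is within
   distance r, uniformly in X. No asymptotic count of the ball is needed. *)
theory Submission
  imports Defs
begin

text \<open>This is the product of the matrix [[0,-1],[1,0]] with \<open>A\<close>, given entrywise
  so that the ratio -c/a of the image can be read off directly.\<close>

definition rotate_rows :: "int mat \<Rightarrow> int mat" where
  "rotate_rows A = mat 2 2 (\<lambda>(i,j). if i = 0 then - A $$ (1,j) else A $$ (0,j))"

lemma rotate_rows_carrier: "rotate_rows A \<in> carrier_mat 2 2"
  by (simp add: rotate_rows_def)

lemma det_rotate_rows:
  assumes "A \<in> carrier_mat 2 2"
  shows "Determinant.det (rotate_rows A) = Determinant.det A"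
proof -
  \<comment> \<open>The quarter turn is a row swap followed by a sign change of the top row; each
    contributes a factor -1 to the determinant.\<close>
  have "rotate_rows A = multrow 0 (-1) (swaprows 0 1 A)"
    using assms by (intro eq_matI) (auto simp: rotate_rows_def less_2_cases_iff)
  moreover have "Determinant.det (multrow 0 (-1) (swaprows 0 1 A)) = Determinant.det A"
    using assms by (simp add: det_multrow[where n = 2] det_swaprows[where n = 2])
  ultimately show ?thesis
    by simp
qed

lemma inj_on_rotate_rows: "inj_on rotate_rows (carrier_mat 2 2)"
proof (rule inj_onI)
  fix A B :: "int mat"
  assume A: "A \<in> carrier_mat 2 2" and B: "B \<in> carrier_mat 2 2"
    and eq: "rotate_rows A = rotate_rows B"
  have top: "A $$ (0,j) = B $$ (0,j)" if "j < 2" for j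
    using arg_cong[OF eq, of "\<lambda>M. M $$ (1,j)"] that by (simp add: rotate_rows_def)
  have bottom: "A $$ (1,j) = B $$ (1,j)" if "j < 2" for j
    using arg_cong[OF eq, of "\<lambda>M. M $$ (0,j)"] that by (simp add: rotate_rows_def)
  show "A = B"
    using A B top bottom by (intro eq_matI) (auto simp: less_2_cases_iff)
qed

text \<open>The rotation is orthogonal, so it leaves the Gram matrix unchanged, and
  \<open>op_norm\<close> depends only on that matrix.\<close>

lemma op_norm_rotate_rows:
  assumes "A \<in> carrier_mat 2 2"
  shows "op_norm (map_mat real_of_int (rotate_rows A)) = op_norm (map_mat real_of_int A)"
proof -
  have "transpose_mat (map_mat real_of_int (rotate_rows A)) * map_mat real_of_int (rotate_rows A)
      = transpose_mat (map_mat real_of_int A) * map_mat real_of_int A"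
    using assms
    by (intro eq_matI) (auto simp: rotate_rows_def scalar_prod_def numeral_2_eq_2)
  then show ?thesis
    by (simp add: op_norm_def)
qed

lemma rotate_rows_in_SL2Z_ball:
  assumes "A \<in> SL2Z_ball X"
  shows "rotate_rows A \<in> SL2Z_ball X"
  using assms
  by (simp add: SL2Z_ball_def SL2Z_def rotate_rows_carrier det_rotate_rows op_norm_rotate_rows)

text \<open>The rotation maps the matrices outside the set on the right injectively into that
  set.\<close>

lemma half_ball_column_ratio_le_1:
  assumes fin: "finite (SL2Z_ball X)"
  shows "card (SL2Z_ball X) \<le> 2 * card {A \<in> SL2Z_ball X. \<bar>column_ratio A\<bar> \<le> 1}"
proof -
  let ?B = "SL2Z_ball X"
  let ?S = "{A \<in> ?B. \<bar>column_ratio A\<bar> \<le> 1}"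
  have "\<bar>column_ratio (rotate_rows A)\<bar> \<le> 1" if "\<not> \<bar>column_ratio A\<bar> \<le> 1" for A
  proof -
    \<comment> \<open>For c = 0 the ratio is 0 by convention, so the assumption forces c to be
      nonzero and |a| > |c|.\<close>
    have "\<bar>A $$ (1,0)\<bar> \<le> \<bar>A $$ (0,0)\<bar>"
      using that by (auto simp: column_ratio_def divide_le_eq_1 simp flip: of_int_abs)
    then show ?thesis
      by (simp add: column_ratio_def rotate_rows_def divide_le_eq_1 flip: of_int_abs)
  qed
  then have "rotate_rows ` (?B - ?S) \<subseteq> ?S"
    using rotate_rows_in_SL2Z_ball by auto
  moreover have "inj_on rotate_rows (?B - ?S)"
    by (rule inj_on_subset[OF inj_on_rotate_rows]) (auto simp: SL2Z_ball_def SL2Z_def)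
  ultimately have "card (?B - ?S) \<le> card ?S"
    using fin by (intro card_inj_on_le) auto
  moreover have "card (?B - ?S) = card ?B - card ?S"
    using fin by (intro card_Diff_subset) auto
  ultimately show ?thesis
    by linarith
qed

text \<open>Pigeonhole by averaging: the fibres over \<open>K\<close> partition \<open>S\<close>, so
  they cannot all be smaller than the average card S / card K.\<close>

lemma card_le_card_times_fibre:
  assumes "finite S" "finite K" "K \<noteq> {}" "f ` S \<subseteq> K"
  shows "\<exists>k\<in>K. card S \<le> card K * card {x \<in> S. f x = k}"
proof (rule ccontr)
  assume "\<not> ?thesis"
  then have small: "card K * card {x \<in> S. f x = k} < card S" if "k \<in> K" for k
    using that by (auto simp: not_le)
  have "card S = (\<Sum>k\<in>K. card {x \<in> S. f x = k})"
    using sum.group[OF assms(1,2,4), of "\<lambda>_. 1::nat"] by simp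
  then have "card K * card S = (\<Sum>k\<in>K. card K * card {x \<in> S. f x = k})"
    by (simp add: sum_distrib_left)
  also have "\<dots> < (\<Sum>k\<in>K. card S)"
    using assms small by (intro sum_strict_mono) auto
  finally show False
    by simp
qed

lemma abs_diff_less_if_floor_divide_eq:
  fixes x y r :: real
  assumes "r > 0" "\<lfloor>x / r\<rfloor> = \<lfloor>y / r\<rfloor>"
  shows "\<bar>x - y\<bar> < r"
proof -
  have "\<bar>x / r - y / r\<bar> < 1"
    using assms(2) by linarith
  then show ?thesis
    using assms(1) by (simp add: abs_less_iff field_simps)
qed

text \<open>The bound does not depend on \<open>X\<close>, which is what the limit argument needs.
  \<open>N\<close> counts the integers of a range containing every floor of x / r with |x| \<le>
  1.\<close>

lemma separated_proportion_le:
  assumes r: "r > 0"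
  defines "N \<equiv> card {- \<lceil>1 / r\<rceil>..\<lceil>1 / r\<rceil>}"
  shows "separated_proportion r X \<le> 1 - 1 / (2 * real N)\<^sup>2"
proof -
  let ?B = "SL2Z_ball X"
  let ?S = "{A \<in> ?B. \<bar>column_ratio A\<bar> \<le> 1}"
  let ?K = "{- \<lceil>1 / r\<rceil>..\<lceil>1 / r\<rceil>}"
  \<comment> \<open>The value k labels the half-open cell [k r, (k+1) r). Half-openness makes the
    distance within a cell strictly less than \<open>r\<close>.\<close>
  let ?f = "\<lambda>A. \<lfloor>column_ratio A / r\<rfloor>"
  have "0 \<le> \<lceil>1 / r\<rceil>"
    using r ceiling_mono[of 0 "1 / r"] by simp
  then have K: "?K \<noteq> {}" and N: "real N \<ge> 1"
    by (auto simp: N_def)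
  show ?thesis
  proof (cases "finite ?B \<and> ?B \<noteq> {}")
    case False
    text \<open>Here the denominator of the proportion is \<open>0\<close>, and HOL's division gives \<open>0\<close>.\<close>
    then have "separated_proportion r X = 0"
      by (auto simp: separated_proportion_def card_cartesian_product)
    moreover have "1 / (2 * real N)\<^sup>2 \<le> 1"
      using one_le_power[of "2 * real N" 2] N by simp
    ultimately show ?thesis
      by simp
  next
    case True
    then have fin: "finite ?B" and b_pos: "card ?B > 0"
      by (auto simp: card_gt_0_iff)
    have "?f ` ?S \<subseteq> ?K"
    proof (rule image_subsetI)
      fix A assume "A \<in> ?S"
      then have "\<bar>column_ratio A\<bar> / r \<le> 1 / r"
        using r by (intro divide_right_mono) auto
      then have "\<bar>column_ratio A / r\<bar> \<le> 1 / r"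
        using r by (simp add: abs_divide)
      \<comment> \<open>The lower end is attained at ratio -1, since the floor of -1/r is minus the
        ceiling of 1/r.\<close>
      then show "?f A \<in> ?K"
        unfolding atLeastAtMost_iff by linarith
    qed
    then obtain k where k: "card ?S \<le> N * card {A \<in> ?S. ?f A = k}"
      using card_le_card_times_fibre[of ?S ?K ?f] fin K by (auto simp: N_def)
    define T where "T = {A \<in> ?S. ?f A = k}"
    have T_sub: "T \<subseteq> ?B"
      by (auto simp: T_def)
    have "card ?B \<le> 2 * N * card T"
      using half_ball_column_ratio_le_1[OF fin] k by (simp add: T_def)
    then have "real (card ?B) \<le> 2 * real N * real (card T)"
      by (metis of_nat_le_iff of_nat_mult of_nat_numeral)
    then have "(real (card ?B))\<^sup>2 \<le> (2 * real N)\<^sup>2 * (real (card T))\<^sup>2"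
      by (metis of_nat_0_le_iff power_mono power_mult_distrib)
    then have T_large: "(real (card ?B))\<^sup>2 / (2 * real N)\<^sup>2 \<le> (real (card T))\<^sup>2"
      using N by (simp add: divide_le_eq mult.commute)
    \<comment> \<open>Both ratios lie in cell \<open>k\<close>, so no pair from T \<times> T is
      separated. This includes matrices with c = 0, whose ratio is 0 by convention.\<close>
    have "\<bar>column_ratio A1 - column_ratio A2\<bar> < r" if "A1 \<in> T" "A2 \<in> T" for A1 A2
      using that r by (intro abs_diff_less_if_floor_divide_eq) (auto simp: T_def)
    then have "separated_pairs r X \<subseteq> ?B \<times> ?B - T \<times> T"
      by (force simp: separated_pairs_def)
    then have "card (separated_pairs r X) \<le> card (?B \<times> ?B - T \<times> T)"
      using fin by (intro card_mono) auto
    also have "\<dots> = card (?B \<times> ?B) - card (T \<times> T)"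
      using fin T_sub by (intro card_Diff_subset) (auto intro: finite_subset)
    finally have "card (separated_pairs r X) \<le> card (?B \<times> ?B) - card (T \<times> T)" .
    moreover have "card (T \<times> T) \<le> card (?B \<times> ?B)"
      using fin T_sub by (intro card_mono) auto
    ultimately have "real (card (separated_pairs r X)) \<le> (real (card ?B))\<^sup>2 - (real (card T))\<^sup>2"
      by (simp add: card_cartesian_product power2_eq_square flip: of_nat_mult)
    also have "\<dots> \<le> (1 - 1 / (2 * real N)\<^sup>2) * (real (card ?B))\<^sup>2"
      using T_large by (simp add: left_diff_distrib)
    finally show ?thesis
      using b_pos
      by (simp add: separated_proportion_def card_cartesian_product pos_divide_le_eq
          power2_eq_square)
  qed
qed

theorem mainTheorem3:
  fixes r :: real
  assumes "r > 0"
  shows "\<not> (separated_proportion r \<longlongrightarrow> 1) at_top"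
proof
  assume lim: "(separated_proportion r \<longlongrightarrow> 1) at_top"
  define N where "N = card {- \<lceil>1 / r\<rceil>..\<lceil>1 / r\<rceil>}"
  have "0 \<le> \<lceil>1 / r\<rceil>"
    using assms ceiling_mono[of 0 "1 / r"] by simp
  then have "N > 0"
    by (simp add: N_def)
  then have "0 < 1 / (2 * real N)\<^sup>2"
    by simp
  \<comment> \<open>A constant upper bound valid for all \<open>X\<close> passes to the limit, here
    assumed to be 1.\<close>
  moreover have "1 \<le> 1 - 1 / (2 * real N)\<^sup>2"
    using separated_proportion_le[OF assms]
    by (intro tendsto_upperbound[OF lim]) (auto simp: N_def)
  ultimately show False
    by linarith
qed

end
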